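(* For any set $\Gamma\cup\{\varphi,\psi\}$ of $\mathcal{PCO}_\sigma$ formulas, if $\Gamma\cup\{\varphi\}\vdash\psi$, then $\Gamma\vdash\varphi\to\psi$.
   Context: Signature $\sigma=(\mathrm{Dom},\mathrm{Ran})$: a finite nonempty set $\mathrm{Dom}$ of variables with a fixed ordering, and finite nonempty value sets $\mathrm{Ran}(X)$; $\mathbf W_V$ lists $\mathrm{Dom}\setminus\{V\}$ in order, $\mathbf W_{XY}$ lists $\mathrm{Dom}\setminus\{X,Y\}$. $\mathbf X=\mathbf x$ abbreviates $X_1=x_1\wedge\dots\wedge X_n=x_n$; it is consistent unless some variable is assigned two distinct values. Language $\mathcal{CO}_\sigma$: $\alpha::= Y=y\mid Y\neq y\mid\alpha\wedge\alpha\mid\alpha\supset\alpha\mid \mathbf X=\mathbf x\,\Box\!\!\to\alpha$ ($y\in\mathrm{Ran}(Y)$, $\mathbf x\in\mathrm{Ran}(\mathbf X)$). Abbreviations: $\top:=X=x\,\Box\!\!\to X=x$, $\bot:=X=x\,\Box\!\!\to X\neq x$ (fixed $X,x$), $\neg\alpha:=\alpha\supset\bot$, $\alpha\vee\beta:=\neg(\neg\alpha\wedge\neg\beta)$, $\alpha\equiv\beta:=(\alpha\supset\beta)\wedge(\beta\supset\alpha)$. Language $\mathcal{PCO}_\sigma$: $\varphi::=\eta\mid\varphi\wedge\varphi\mid\varphi\sqcup\varphi\mid\alpha\supset\varphi\mid\mathbf X=\mathbf x\,\Box\!\!\to\varphi$, $\alpha\in\mathcal{CO}$, $\eta$ a literal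 $Y=y$, $Y\neq y$ or a probabilistic atom $\Pr(\alpha)\geq\epsilon$, $\Pr(\alpha)>\epsilon$, $\Pr(\alpha)\geq\Pr(\beta)$, $\Pr(\alpha)>\Pr(\beta)$ ($\alpha,\beta\in\mathcal{CO}$, $\epsilon\in[0,1]\cap\mathbb Q$). Abbreviations: $\Pr(\alpha)\leq\epsilon:=\Pr(\neg\alpha)\geq1-\epsilon$; $\Pr(\alpha)<\epsilon:=\Pr(\neg\alpha)>1-\epsilon$; $\Pr(\alpha)=\epsilon:=\Pr(\alpha)\geq\epsilon\wedge\Pr(\alpha)\leq\epsilon$; $\Pr(\alpha)\neq\epsilon:=\Pr(\alpha)>\epsilon\sqcup\Pr(\alpha)<\epsilon$. The operation $\varphi\mapsto\varphi^C$: $(\Pr(\alpha)\geq\epsilon)^C=\Pr(\alpha)<\epsilon$ and vice versa; $(\Pr(\alpha)>\epsilon)^C=\Pr(\alpha)\leq\epsilon$ and vice versa; $(\Pr(\alpha)=\epsilon)^C=\Pr(\alpha)\neq\epsilon$ and vice versa; $(\Pr(\alpha)\geq\Pr(\beta))^C=\Pr(\beta)>\Pr(\alpha)$ and vice versa; $\bot^C=\top$ and vice versa; $(X=x)^C=\Pr(X=x)<1$; $(X\neq x)^C=\Pr(X\neq x)<1$; $(\psi\wedge\chi)^C=\psi^C\sqcup\chi^C$; $(\psi\sqcup\chi)^C=\psi^C\wedge\chi^C$; $(\alpha\supset\chi)^C=\Pr(\alpha)>0\wedge\alpha\supset\chi^C$; $(\mathbf X=\mathbf x\,\Box\!\!\to\chi)^C=\mathbf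 X=\mathbf x\,\Box\!\!\to\chi^C$. $\psi\to\chi:=\psi^C\sqcup\chi$, $\psi\leftrightarrow\chi:=(\psi\to\chi)\wedge(\chi\to\psi)$; $\mathbf Y\neq\mathbf y:=Y_1\neq y_1\sqcup\dots\sqcup Y_n\neq y_n$; $\bigvee,\bigsqcup,\bigwedge$ iterate $\vee,\sqcup,\wedge$. Auxiliary formulas: $\varphi_{DC(X,Y)}:=\bigvee_{x\neq x',\,y\neq y',\,\mathbf w\in\mathrm{Ran}(\mathbf W_{XY})}[((\mathbf W_{XY}=\mathbf w\wedge X=x)\Box\!\!\to Y=y)\wedge((\mathbf W_{XY}=\mathbf w\wedge X=x')\Box\!\!\to Y=y')]$; $\varphi_{End(Y)}:=\bigsqcup_{X\in\mathbf W_Y}\varphi_{DC(X,Y)}$; $X\leadsto Y:=\bigvee_{\mathbf Z\subseteq\mathrm{Dom}\setminus\{X\},\,\mathbf z,\,x\neq x',\,y\neq y'}[((\mathbf Z=\mathbf z\wedge X=x)\Box\!\!\to Y=y)\wedge((\mathbf Z=\mathbf z\wedge X=x')\Box\!\!\to Y=y')]$. Deduction system ($\alpha,\beta$ in $\mathcal{CO}$; $\psi,\chi,\varphi,\theta$ in $\mathcal{PCO}$; $\delta,\epsilon\in[0,1]\cap\mathbb Q$). Axioms: T1: substitution instances of classical tautologies in $\wedge,\sqcup,\to,{}^C,\top,\bot$. T2: $\mathcal{CO}$ instances of classical tautologies in $\wedge,\vee,\supset,\neg,\top,\bot$. P1: $\alpha\leftrightarrow\Pr(\alpha)=1$. P2: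 $\Pr(\alpha)\geq0$. P3: $(\Pr(\alpha)=\delta\wedge\Pr(\beta)=\epsilon\wedge\Pr(\alpha\wedge\beta)=0)\to\Pr(\alpha\vee\beta)=\delta+\epsilon$ ($\delta+\epsilon\leq1$). P3b: $\Pr(\alpha)\geq\epsilon\wedge\Pr(\alpha\wedge\beta)=0\to\Pr(\beta)\leq1-\epsilon$. P4: $\Pr(\alpha)\leq\epsilon\to\Pr(\alpha)<\delta$ ($\delta>\epsilon$). P5: $\Pr(\alpha)<\epsilon\to\Pr(\alpha)\leq\epsilon$. P6: $\Pr(\alpha\equiv\beta)=1\to(\Pr(\alpha)=\epsilon\to\Pr(\beta)=\epsilon)$. P6b: $\Pr(\alpha\supset\beta)=1\to(\Pr(\alpha)=\epsilon\to\Pr(\beta)\geq\epsilon)$. CP1: $(\Pr(\alpha)=\delta\wedge\Pr(\beta)=\epsilon)\to\Pr(\alpha)\geq\Pr(\beta)$ ($\delta\geq\epsilon$). CP2: same with $>$ ($\delta>\epsilon$). O1: $\Pr(\alpha)=0\to(\alpha\supset\psi)$. O1b: $(\alpha\supset\bot)\to\Pr(\alpha)=0$. O2: $(\Pr(\alpha)=\delta\wedge\Pr(\alpha\wedge\beta)=\epsilon)\to(\alpha\supset\Pr(\beta)=\frac{\epsilon}{\delta})$ ($\delta\neq0$). O3: $(\alpha\supset\Pr(\beta)=\epsilon)\to(\Pr(\alpha)=\delta\leftrightarrow\Pr(\alpha\wedge\beta)=\epsilon\cdot\delta)$ ($\epsilon\neq0$). O4: $(\alpha\supset\psi)\to(\alpha\to\psi)$.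 O5$_\wedge$: $\alpha\supset(\psi\wedge\chi)\leftrightarrow(\alpha\supset\psi)\wedge(\alpha\supset\chi)$. O5$_\sqcup$: same with $\sqcup$. O5$_\supset$: $\alpha\supset(\beta\supset\chi)\leftrightarrow(\alpha\wedge\beta)\supset\chi$. A1: $\mathbf Y=\mathbf y\to\mathbf Y\neq\mathbf y'$ ($\mathbf y\neq\mathbf y'$). A2: $X\neq x\leftrightarrow(X=x\supset\bot)$. A3: $\bigvee_{\mathbf y\in\mathrm{Ran}(\mathbf Y)}\mathbf Y=\mathbf y$. C1: $(\mathbf X=\mathbf x\Box\!\!\to(\psi\wedge\chi))\leftrightarrow((\mathbf X=\mathbf x\Box\!\!\to\psi)\wedge(\mathbf X=\mathbf x\Box\!\!\to\chi))$. C2: same with $\sqcup$. C3: $(\mathbf X=\mathbf x\Box\!\!\to(\alpha\supset\chi))\leftrightarrow((\mathbf X=\mathbf x\Box\!\!\to\alpha)\supset(\mathbf X=\mathbf x\Box\!\!\to\chi))$. C4: $(\mathbf X=\mathbf x\Box\!\!\to(\mathbf Y=\mathbf y\Box\!\!\to\chi))\to((\mathbf X'=\mathbf x'\wedge\mathbf Y=\mathbf y)\Box\!\!\to\chi)$, $\mathbf X'=\mathbf X\setminus\mathbf Y$, $\mathbf x'$ corresponding values, $\mathbf X=\mathbf x$ consistent. C4b: $((\mathbf X=\mathbf x\wedge\mathbf Y=\mathbf y)\Box\!\!\to\chi)\to(\mathbf X=\mathbf x\Box\!\!\to(\mathbf Y=\mathbf y\Box\!\!\to\chi))$. C5: $(\mathbf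 X=\mathbf x\Box\!\!\to\bot)\to\psi$ ($\mathbf X=\mathbf x$ consistent). C6: $(\mathbf X=\mathbf x\wedge Y=y)\Box\!\!\to Y=y$. C7: $(\mathbf X=\mathbf x\wedge\gamma)\to(\mathbf X=\mathbf x\Box\!\!\to\gamma)$, $\gamma\in\mathcal{PCO}$ without $\Box\!\!\to$. C8: $(\mathbf X=\mathbf x\Box\!\!\to\Pr(\alpha)\rhd\epsilon)\leftrightarrow\Pr(\mathbf X=\mathbf x\Box\!\!\to\alpha)\rhd\epsilon$ ($\rhd\in\{\geq,>\}$). C8b: $(\mathbf X=\mathbf x\Box\!\!\to\Pr(\alpha)\rhd\Pr(\beta))\leftrightarrow\Pr(\mathbf X=\mathbf x\Box\!\!\to\alpha)\rhd\Pr(\mathbf X=\mathbf x\Box\!\!\to\beta)$. C9: $\varphi_{End(Y)}\to(\mathbf W_Y=\mathbf w\Box\!\!\to\bigsqcup_{y}Y=y)$. C10: $(\varphi_{End(Y)})^C\to(Y=y\supset(\mathbf W_Y=\mathbf w\Box\!\!\to Y=y))$. C11: $(X_1\leadsto X_2\wedge\dots\wedge X_{n-1}\leadsto X_n)\to(X_n\leadsto X_1)^C$ ($n>1$). Rules: MP (from $\psi$, $\psi\to\chi$ infer $\chi$); Rep (from $\vdash\varphi$, $\vdash\theta\leftrightarrow\theta'$ infer $\vdash\varphi[\theta'/\theta]$ if well-formed); $\bot^\omega$ (from $\psi\to\Pr(\alpha)\neq\epsilon$ for all $\epsilon\in[0,1]\cap\mathbb Q$ infer $\psi\to\bot$); Mon$_\supset$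 (from $\vdash\psi\to\chi$ infer $\vdash(\alpha\supset\psi)\to(\alpha\supset\chi)$); $\to$to$\supset$ (from $\vdash\alpha\to\psi$ infer $\vdash\alpha\supset\psi$); $\supset^\omega$ (from $\psi\to(\Pr(\alpha\wedge\beta)=\delta\epsilon\leftrightarrow\Pr(\alpha)=\epsilon)$ for all $\epsilon\in(0,1]\cap\mathbb Q$ infer $\psi\to(\alpha\supset\Pr(\beta)=\delta)$); Mon$_{\Box\!\to}$ (from $\vdash\psi\to\chi$ infer $\vdash(\mathbf X=\mathbf x\Box\!\!\to\psi)\to(\mathbf X=\mathbf x\Box\!\!\to\chi)$). $\Gamma\vdash\varphi$ iff there is a sequence indexed by ordinals $\leq\kappa$ (countable) ending in $\varphi$, each term an axiom, in $\Gamma$, or obtained from earlier terms by a rule, where Rep, Mon$_\supset$, Mon$_{\Box\!\to}$, $\to$to$\supset$ apply only to theorems (formulas derivable from $\emptyset$).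
   Formalization: In axiom C11 the variables X_1,…,X_n are taken pairwise distinct (with X_1=X_2 the axiom makes the system inconsistent, since X⇝X is derivable when X has two values), and O2 is restricted to ε ≤ δ so that ε/δ lies in [0,1]. *)

theory Defs
  imports Complex_Main
begin

section \<open>Syntax\<close>

text \<open>
  One datatype carries the symbols of both languages; the sets \<open>CO\<close> and \<open>PCO\<close> below carve
  out the well-formed formulas, so that literally \<open>CO \<subseteq> PCO\<close>. The antecedent
  \<open>X\<^sub>1 = x\<^sub>1 \<and> \<dots> \<and> X\<^sub>n = x\<^sub>n\<close> of a counterfactual is the list of pairs \<open>(X\<^sub>i, x\<^sub>i)\<close>, possibly
  with repetitions or inconsistent, and possibly empty (\<open>W\<^sub>Y\<close> is empty if \<open>Dom = {Y}\<close>).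
\<close>

datatype ('v, 'a) fm =
    Eq 'v 'a                        (infix "\<^bold>=" 60)
  | Neq 'v 'a                       (infix "\<^bold>\<noteq>" 60)
  | Conj "('v, 'a) fm" "('v, 'a) fm"    (infixr "\<^bold>\<and>" 45)
  | GDisj "('v, 'a) fm" "('v, 'a) fm"   (infixr "\<^bold>\<squnion>" 40)
  | Obs "('v, 'a) fm" "('v, 'a) fm"     (infixr "\<^bold>\<supset>" 50)
  | Cf "('v \<times> 'a) list" "('v, 'a) fm"   (infixr "\<^bold>\<box>" 55)
  | PrGe "('v, 'a) fm" rat
  | PrGt "('v, 'a) fm" rat
  | PrGeP "('v, 'a) fm" "('v, 'a) fm"
  | PrGtP "('v, 'a) fm" "('v, 'a) fm"

text \<open>No counterfactual anywhere, also not inside \<open>Pr\<close> or to the left of \<open>\<^bold>\<supset>\<close>.\<close>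

primrec cf_free :: "('v, 'a) fm \<Rightarrow> bool" where
  "cf_free (X \<^bold>= x) \<longleftrightarrow> True"
| "cf_free (X \<^bold>\<noteq> x) \<longleftrightarrow> True"
| "cf_free (\<phi> \<^bold>\<and> \<psi>) \<longleftrightarrow> cf_free \<phi> \<and> cf_free \<psi>"
| "cf_free (\<phi> \<^bold>\<squnion> \<psi>) \<longleftrightarrow> cf_free \<phi> \<and> cf_free \<psi>"
| "cf_free (\<phi> \<^bold>\<supset> \<psi>) \<longleftrightarrow> cf_free \<phi> \<and> cf_free \<psi>"
| "cf_free (xs \<^bold>\<box> \<phi>) \<longleftrightarrow> False"
| "cf_free (PrGe \<phi> \<epsilon>) \<longleftrightarrow> cf_free \<phi>"
| "cf_free (PrGt \<phi> \<epsilon>) \<longleftrightarrow> cf_free \<phi>"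
| "cf_free (PrGeP \<phi> \<psi>) \<longleftrightarrow> cf_free \<phi> \<and> cf_free \<psi>"
| "cf_free (PrGtP \<phi> \<psi>) \<longleftrightarrow> cf_free \<phi> \<and> cf_free \<psi>"

text \<open>
  \<open>repl \<theta> \<theta>' \<phi>\<close> is \<open>\<phi>[\<theta>'/\<theta>]\<close>: all occurrences of the subformula \<open>\<theta>\<close> are replaced, including
  those inside \<open>Pr\<close> and to the left of \<open>\<^bold>\<supset>\<close>. Antecedents of counterfactuals are not subformulas.
\<close>

primrec repl :: "('v, 'a) fm \<Rightarrow> ('v, 'a) fm \<Rightarrow> ('v, 'a) fm \<Rightarrow> ('v, 'a) fm" where
  "repl \<theta> \<theta>' (X \<^bold>= x) = (if (X \<^bold>= x) = \<theta> then \<theta>' else (X \<^bold>= x))"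
| "repl \<theta> \<theta>' (X \<^bold>\<noteq> x) = (if (X \<^bold>\<noteq> x) = \<theta> then \<theta>' else (X \<^bold>\<noteq> x))"
| "repl \<theta> \<theta>' (\<phi> \<^bold>\<and> \<psi>) = (if (\<phi> \<^bold>\<and> \<psi>) = \<theta> then \<theta>' else (repl \<theta> \<theta>' \<phi> \<^bold>\<and> repl \<theta> \<theta>' \<psi>))"
| "repl \<theta> \<theta>' (\<phi> \<^bold>\<squnion> \<psi>) = (if (\<phi> \<^bold>\<squnion> \<psi>) = \<theta> then \<theta>' else (repl \<theta> \<theta>' \<phi> \<^bold>\<squnion> repl \<theta> \<theta>' \<psi>))"
| "repl \<theta> \<theta>' (\<phi> \<^bold>\<supset> \<psi>) = (if (\<phi> \<^bold>\<supset> \<psi>) = \<theta> then \<theta>' else (repl \<theta> \<theta>' \<phi> \<^bold>\<supset> repl \<theta> \<theta>' \<psi>))"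
| "repl \<theta> \<theta>' (xs \<^bold>\<box> \<phi>) = (if (xs \<^bold>\<box> \<phi>) = \<theta> then \<theta>' else (xs \<^bold>\<box> repl \<theta> \<theta>' \<phi>))"
| "repl \<theta> \<theta>' (PrGe \<phi> \<epsilon>) = (if PrGe \<phi> \<epsilon> = \<theta> then \<theta>' else PrGe (repl \<theta> \<theta>' \<phi>) \<epsilon>)"
| "repl \<theta> \<theta>' (PrGt \<phi> \<epsilon>) = (if PrGt \<phi> \<epsilon> = \<theta> then \<theta>' else PrGt (repl \<theta> \<theta>' \<phi>) \<epsilon>)"
| "repl \<theta> \<theta>' (PrGeP \<phi> \<psi>) =
     (if PrGeP \<phi> \<psi> = \<theta> then \<theta>' else PrGeP (repl \<theta> \<theta>' \<phi>) (repl \<theta> \<theta>' \<psi>))"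
| "repl \<theta> \<theta>' (PrGtP \<phi> \<psi>) =
     (if PrGtP \<phi> \<psi> = \<theta> then \<theta>' else PrGtP (repl \<theta> \<theta>' \<phi>) (repl \<theta> \<theta>' \<psi>))"

definition consistent :: "('v \<times> 'a) list \<Rightarrow> bool" where
  "consistent xs \<longleftrightarrow> (\<forall>X x x'. (X, x) \<in> set xs \<longrightarrow> (X, x') \<in> set xs \<longrightarrow> x = x')"

text \<open>Classical propositional formulas, used for the tautology axioms.\<close>

datatype pfm =
  PVar nat | PTop | PBot | PNeg pfm | PAnd pfm pfm | POr pfm pfm | PImp pfm pfm

primrec peval :: "(nat \<Rightarrow> bool) \<Rightarrow> pfm \<Rightarrow> bool" where
  "peval v (PVar n) \<longleftrightarrow> v n"
| "peval v PTop \<longleftrightarrow> True"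
| "peval v PBot \<longleftrightarrow> False"
| "peval v (PNeg p) \<longleftrightarrow> \<not> peval v p"
| "peval v (PAnd p q) \<longleftrightarrow> peval v p \<and> peval v q"
| "peval v (POr p q) \<longleftrightarrow> peval v p \<or> peval v q"
| "peval v (PImp p q) \<longleftrightarrow> (peval v p \<longrightarrow> peval v q)"

definition tautology :: "pfm \<Rightarrow> bool" where
  "tautology p \<longleftrightarrow> (\<forall>v. peval v p)"

section \<open>Signatures and abbreviations\<close>

text \<open>
  \<open>Dom\<close> is listed in its fixed order. The value sets \<open>Ran X\<close> are listed too, in an arbitrary
  order, so that the iterated disjunctions over them denote definite formulas. \<open>X0\<close> and \<open>x0\<close>
  are the fixed variable and value in the definitions of \<open>\<top>\<close> and \<open>\<bottom>\<close>.
\<close>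

record ('v, 'a) sig =
  Dom :: "'v list"
  Ran :: "'v \<Rightarrow> 'a list"
  X0 :: 'v
  x0 :: 'a

locale signature =
  fixes \<sigma> :: "('v, 'a) sig"
  assumes Dom_distinct: "distinct (Dom \<sigma>)"
    and Dom_nonempty: "Dom \<sigma> \<noteq> []"
    and Ran_distinct: "X \<in> set (Dom \<sigma>) \<Longrightarrow> distinct (Ran \<sigma> X)"
    and Ran_nonempty: "X \<in> set (Dom \<sigma>) \<Longrightarrow> Ran \<sigma> X \<noteq> []"
    and X0_in_Dom: "X0 \<sigma> \<in> set (Dom \<sigma>)"
    and x0_in_Ran: "x0 \<sigma> \<in> set (Ran \<sigma> (X0 \<sigma>))"
begin

definition assignments :: "('v \<times> 'a) list set" where
  "assignments = {xs. \<forall>(X, x) \<in> set xs. X \<in> set (Dom \<sigma>) \<and> x \<in> set (Ran \<sigma> X)}"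

inductive_set CO :: "('v, 'a) fm set" where
  "X \<in> set (Dom \<sigma>) \<Longrightarrow> x \<in> set (Ran \<sigma> X) \<Longrightarrow> (X \<^bold>= x) \<in> CO"
| "X \<in> set (Dom \<sigma>) \<Longrightarrow> x \<in> set (Ran \<sigma> X) \<Longrightarrow> (X \<^bold>\<noteq> x) \<in> CO"
| "\<alpha> \<in> CO \<Longrightarrow> \<beta> \<in> CO \<Longrightarrow> (\<alpha> \<^bold>\<and> \<beta>) \<in> CO"
| "\<alpha> \<in> CO \<Longrightarrow> \<beta> \<in> CO \<Longrightarrow> (\<alpha> \<^bold>\<supset> \<beta>) \<in> CO"
| "xs \<in> assignments \<Longrightarrow> \<alpha> \<in> CO \<Longrightarrow> (xs \<^bold>\<box> \<alpha>) \<in> CO"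

inductive_set PCO :: "('v, 'a) fm set" where
  "X \<in> set (Dom \<sigma>) \<Longrightarrow> x \<in> set (Ran \<sigma> X) \<Longrightarrow> (X \<^bold>= x) \<in> PCO"
| "X \<in> set (Dom \<sigma>) \<Longrightarrow> x \<in> set (Ran \<sigma> X) \<Longrightarrow> (X \<^bold>\<noteq> x) \<in> PCO"
| "\<alpha> \<in> CO \<Longrightarrow> \<epsilon> \<in> {0..1} \<Longrightarrow> PrGe \<alpha> \<epsilon> \<in> PCO"
| "\<alpha> \<in> CO \<Longrightarrow> \<epsilon> \<in> {0..1} \<Longrightarrow> PrGt \<alpha> \<epsilon> \<in> PCO"
| "\<alpha> \<in> CO \<Longrightarrow> \<beta> \<in> CO \<Longrightarrow> PrGeP \<alpha> \<beta> \<in> PCO"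
| "\<alpha> \<in> CO \<Longrightarrow> \<beta> \<in> CO \<Longrightarrow> PrGtP \<alpha> \<beta> \<in> PCO"
| "\<phi> \<in> PCO \<Longrightarrow> \<psi> \<in> PCO \<Longrightarrow> (\<phi> \<^bold>\<and> \<psi>) \<in> PCO"
| "\<phi> \<in> PCO \<Longrightarrow> \<psi> \<in> PCO \<Longrightarrow> (\<phi> \<^bold>\<squnion> \<psi>) \<in> PCO"
| "\<alpha> \<in> CO \<Longrightarrow> \<phi> \<in> PCO \<Longrightarrow> (\<alpha> \<^bold>\<supset> \<phi>) \<in> PCO"
| "xs \<in> assignments \<Longrightarrow> \<phi> \<in> PCO \<Longrightarrow> (xs \<^bold>\<box> \<phi>) \<in> PCO"

definition top :: "('v, 'a) fm"  ("\<^bold>\<top>") where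
  "\<^bold>\<top> = ([(X0 \<sigma>, x0 \<sigma>)] \<^bold>\<box> (X0 \<sigma> \<^bold>= x0 \<sigma>))"

definition bot :: "('v, 'a) fm"  ("\<^bold>\<bottom>") where
  "\<^bold>\<bottom> = ([(X0 \<sigma>, x0 \<sigma>)] \<^bold>\<box> (X0 \<sigma> \<^bold>\<noteq> x0 \<sigma>))"

definition neg :: "('v, 'a) fm \<Rightarrow> ('v, 'a) fm"  ("\<^bold>\<not> _" [70] 70) where
  "\<^bold>\<not> \<alpha> = (\<alpha> \<^bold>\<supset> \<^bold>\<bottom>)"

definition disj :: "('v, 'a) fm \<Rightarrow> ('v, 'a) fm \<Rightarrow> ('v, 'a) fm"  (infixr "\<^bold>\<or>" 40) where
  "(\<alpha> \<^bold>\<or> \<beta>) = \<^bold>\<not> (\<^bold>\<not> \<alpha> \<^bold>\<and> \<^bold>\<not> \<beta>)"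

definition equiv :: "('v, 'a) fm \<Rightarrow> ('v, 'a) fm \<Rightarrow> ('v, 'a) fm"  (infix "\<^bold>\<equiv>" 35) where
  "(\<alpha> \<^bold>\<equiv> \<beta>) = ((\<alpha> \<^bold>\<supset> \<beta>) \<^bold>\<and> (\<beta> \<^bold>\<supset> \<alpha>))"

definition PrLe :: "('v, 'a) fm \<Rightarrow> rat \<Rightarrow> ('v, 'a) fm" where
  "PrLe \<alpha> \<epsilon> = PrGe (\<^bold>\<not> \<alpha>) (1 - \<epsilon>)"

definition PrLt :: "('v, 'a) fm \<Rightarrow> rat \<Rightarrow> ('v, 'a) fm" where
  "PrLt \<alpha> \<epsilon> = PrGt (\<^bold>\<not> \<alpha>) (1 - \<epsilon>)"

definition PrEq :: "('v, 'a) fm \<Rightarrow> rat \<Rightarrow> ('v, 'a) fm" where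
  "PrEq \<alpha> \<epsilon> = (PrGe \<alpha> \<epsilon> \<^bold>\<and> PrLe \<alpha> \<epsilon>)"

definition PrNe :: "('v, 'a) fm \<Rightarrow> rat \<Rightarrow> ('v, 'a) fm" where
  "PrNe \<alpha> \<epsilon> = (PrGt \<alpha> \<epsilon> \<^bold>\<squnion> PrLt \<alpha> \<epsilon>)"

text \<open>
  The clauses for \<open>\<phi>\<^sup>C\<close> overlap: \<open>\<bottom>\<close>, \<open>\<top>\<close> are also counterfactuals, \<open>Pr(\<alpha>) = \<epsilon>\<close> is also a
  conjunction, \<open>Pr(\<alpha>) \<noteq> \<epsilon>\<close> is also a disjunction, and \<open>Pr(\<alpha>) \<le> \<epsilon>\<close>, \<open>Pr(\<alpha>) < \<epsilon>\<close> are also atoms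
  \<open>Pr(\<not>\<alpha>) \<ge> 1 - \<epsilon>\<close>, \<open>Pr(\<not>\<alpha>) > 1 - \<epsilon>\<close>. A clause for an abbreviation takes precedence over the
  clause for the primitive symbol it is built from. The functions \<open>un_neg\<close>, \<open>un_PrEq\<close>,
  \<open>un_PrNe\<close> recognise the abbreviations.
\<close>

definition un_neg :: "('v, 'a) fm \<Rightarrow> ('v, 'a) fm option" where
  "un_neg \<phi> = (case \<phi> of \<alpha> \<^bold>\<supset> \<beta> \<Rightarrow> if \<beta> = \<^bold>\<bottom> then Some \<alpha> else None | _ \<Rightarrow> None)"

definition un_PrEq :: "('v, 'a) fm \<Rightarrow> (('v, 'a) fm \<times> rat) option" where
  "un_PrEq \<phi> = (case \<phi> of
     PrGe \<alpha> \<epsilon> \<^bold>\<and> \<psi> \<Rightarrow> if \<psi> = PrLe \<alpha> \<epsilon> then Some (\<alpha>, \<epsilon>) else None | _ \<Rightarrow> None)"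

definition un_PrNe :: "('v, 'a) fm \<Rightarrow> (('v, 'a) fm \<times> rat) option" where
  "un_PrNe \<phi> = (case \<phi> of
     PrGt \<alpha> \<epsilon> \<^bold>\<squnion> \<psi> \<Rightarrow> if \<psi> = PrLt \<alpha> \<epsilon> then Some (\<alpha>, \<epsilon>) else None | _ \<Rightarrow> None)"

primrec compl :: "('v, 'a) fm \<Rightarrow> ('v, 'a) fm" where
  "compl (X \<^bold>= x) = PrLt (X \<^bold>= x) 1"
| "compl (X \<^bold>\<noteq> x) = PrLt (X \<^bold>\<noteq> x) 1"
| "compl (PrGe \<alpha> \<epsilon>) =
     (case un_neg \<alpha> of Some \<beta> \<Rightarrow> PrGt \<beta> (1 - \<epsilon>) | None \<Rightarrow> PrLt \<alpha> \<epsilon>)"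
| "compl (PrGt \<alpha> \<epsilon>) =
     (case un_neg \<alpha> of Some \<beta> \<Rightarrow> PrGe \<beta> (1 - \<epsilon>) | None \<Rightarrow> PrLe \<alpha> \<epsilon>)"
| "compl (PrGeP \<alpha> \<beta>) = PrGtP \<beta> \<alpha>"
| "compl (PrGtP \<alpha> \<beta>) = PrGeP \<beta> \<alpha>"
| "compl (\<psi> \<^bold>\<and> \<chi>) =
     (case un_PrEq (\<psi> \<^bold>\<and> \<chi>) of Some (\<alpha>, \<epsilon>) \<Rightarrow> PrNe \<alpha> \<epsilon> | None \<Rightarrow> (compl \<psi> \<^bold>\<squnion> compl \<chi>))"
| "compl (\<psi> \<^bold>\<squnion> \<chi>) =
     (case un_PrNe (\<psi> \<^bold>\<squnion> \<chi>) of Some (\<alpha>, \<epsilon>) \<Rightarrow> PrEq \<alpha> \<epsilon> | None \<Rightarrow> (compl \<psi> \<^bold>\<and> compl \<chi>))"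
| "compl (\<alpha> \<^bold>\<supset> \<chi>) = (PrGt \<alpha> 0 \<^bold>\<and> (\<alpha> \<^bold>\<supset> compl \<chi>))"
| "compl (xs \<^bold>\<box> \<chi>) =
     (if (xs \<^bold>\<box> \<chi>) = \<^bold>\<bottom> then \<^bold>\<top> else if (xs \<^bold>\<box> \<chi>) = \<^bold>\<top> then \<^bold>\<bottom> else (xs \<^bold>\<box> compl \<chi>))"

definition imp :: "('v, 'a) fm \<Rightarrow> ('v, 'a) fm \<Rightarrow> ('v, 'a) fm"  (infixr "\<^bold>\<longrightarrow>" 30) where
  "(\<psi> \<^bold>\<longrightarrow> \<chi>) = (compl \<psi> \<^bold>\<squnion> \<chi>)"

definition iff :: "('v, 'a) fm \<Rightarrow> ('v, 'a) fm \<Rightarrow> ('v, 'a) fm"  (infix "\<^bold>\<longleftrightarrow>" 30) where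
  "(\<psi> \<^bold>\<longleftrightarrow> \<chi>) = ((\<psi> \<^bold>\<longrightarrow> \<chi>) \<^bold>\<and> (\<chi> \<^bold>\<longrightarrow> \<psi>))"

text \<open>
  Iterated connectives associate to the right; the empty conjunction is \<open>\<top>\<close> and the empty
  disjunctions are \<open>\<bottom>\<close>.
\<close>

fun big_conj :: "('v, 'a) fm list \<Rightarrow> ('v, 'a) fm" where
  "big_conj [] = \<^bold>\<top>"
| "big_conj [\<phi>] = \<phi>"
| "big_conj (\<phi> # \<psi> # \<phi>s) = (\<phi> \<^bold>\<and> big_conj (\<psi> # \<phi>s))"

fun big_disj :: "('v, 'a) fm list \<Rightarrow> ('v, 'a) fm" where
  "big_disj [] = \<^bold>\<bottom>"
| "big_disj [\<phi>] = \<phi>"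
| "big_disj (\<phi> # \<psi> # \<phi>s) = (\<phi> \<^bold>\<or> big_disj (\<psi> # \<phi>s))"

fun big_gdisj :: "('v, 'a) fm list \<Rightarrow> ('v, 'a) fm" where
  "big_gdisj [] = \<^bold>\<bottom>"
| "big_gdisj [\<phi>] = \<phi>"
| "big_gdisj (\<phi> # \<psi> # \<phi>s) = (\<phi> \<^bold>\<squnion> big_gdisj (\<psi> # \<phi>s))"

definition eqs :: "('v \<times> 'a) list \<Rightarrow> ('v, 'a) fm" where
  "eqs xs = big_conj (map (\<lambda>(X, x). X \<^bold>= x) xs)"

definition neqs :: "('v \<times> 'a) list \<Rightarrow> ('v, 'a) fm" where
  "neqs xs = big_gdisj (map (\<lambda>(X, x). X \<^bold>\<noteq> x) xs)"

definition tuples :: "'v list \<Rightarrow> 'a list list" where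
  "tuples Vs = product_lists (map (Ran \<sigma>) Vs)"

definition W1 :: "'v \<Rightarrow> 'v list" where
  "W1 Y = [V \<leftarrow> Dom \<sigma>. V \<noteq> Y]"

definition W2 :: "'v \<Rightarrow> 'v \<Rightarrow> 'v list" where
  "W2 X Y = [V \<leftarrow> Dom \<sigma>. V \<noteq> X \<and> V \<noteq> Y]"

definition DC :: "'v \<Rightarrow> 'v \<Rightarrow> ('v, 'a) fm" where
  "DC X Y = big_disj
     [((zip (W2 X Y) w @ [(X, x)]) \<^bold>\<box> (Y \<^bold>= y)) \<^bold>\<and> ((zip (W2 X Y) w @ [(X, x')]) \<^bold>\<box> (Y \<^bold>= y')).
      x \<leftarrow> Ran \<sigma> X, x' \<leftarrow> Ran \<sigma> X, x \<noteq> x',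
      y \<leftarrow> Ran \<sigma> Y, y' \<leftarrow> Ran \<sigma> Y, y \<noteq> y', w \<leftarrow> tuples (W2 X Y)]"

definition End :: "'v \<Rightarrow> ('v, 'a) fm" where
  "End Y = big_gdisj [DC X Y. X \<leftarrow> W1 Y]"

definition affects :: "'v \<Rightarrow> 'v \<Rightarrow> ('v, 'a) fm"  (infix "\<^bold>\<leadsto>" 60) where
  "(X \<^bold>\<leadsto> Y) = big_disj
     [((zip Z z @ [(X, x)]) \<^bold>\<box> (Y \<^bold>= y)) \<^bold>\<and> ((zip Z z @ [(X, x')]) \<^bold>\<box> (Y \<^bold>= y')).
      Z \<leftarrow> subseqs (W1 X), z \<leftarrow> tuples Z,
      x \<leftarrow> Ran \<sigma> X, x' \<leftarrow> Ran \<sigma> X, x \<noteq> x', y \<leftarrow> Ran \<sigma> Y, y' \<leftarrow> Ran \<sigma> Y, y \<noteq> y']"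

primrec inst_PCO :: "(nat \<Rightarrow> ('v, 'a) fm) \<Rightarrow> pfm \<Rightarrow> ('v, 'a) fm" where
  "inst_PCO s (PVar n) = s n"
| "inst_PCO s PTop = \<^bold>\<top>"
| "inst_PCO s PBot = \<^bold>\<bottom>"
| "inst_PCO s (PNeg p) = compl (inst_PCO s p)"
| "inst_PCO s (PAnd p q) = (inst_PCO s p \<^bold>\<and> inst_PCO s q)"
| "inst_PCO s (POr p q) = (inst_PCO s p \<^bold>\<squnion> inst_PCO s q)"
| "inst_PCO s (PImp p q) = (inst_PCO s p \<^bold>\<longrightarrow> inst_PCO s q)"

primrec inst_CO :: "(nat \<Rightarrow> ('v, 'a) fm) \<Rightarrow> pfm \<Rightarrow> ('v, 'a) fm" where
  "inst_CO s (PVar n) = s n"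
| "inst_CO s PTop = \<^bold>\<top>"
| "inst_CO s PBot = \<^bold>\<bottom>"
| "inst_CO s (PNeg p) = \<^bold>\<not> (inst_CO s p)"
| "inst_CO s (PAnd p q) = (inst_CO s p \<^bold>\<and> inst_CO s q)"
| "inst_CO s (POr p q) = (inst_CO s p \<^bold>\<or> inst_CO s q)"
| "inst_CO s (PImp p q) = (inst_CO s p \<^bold>\<supset> inst_CO s q)"

section \<open>The deduction system\<close>

inductive_set axioms :: "('v, 'a) fm set" where
  T1: "tautology p \<Longrightarrow> (\<And>n. s n \<in> PCO) \<Longrightarrow> inst_PCO s p \<in> axioms"
| T2: "tautology p \<Longrightarrow> (\<And>n. s n \<in> CO) \<Longrightarrow> inst_CO s p \<in> axioms"

| P1: "\<alpha> \<in> CO \<Longrightarrow> (\<alpha> \<^bold>\<longleftrightarrow> PrEq \<alpha> 1) \<in> axioms"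
| P2: "\<alpha> \<in> CO \<Longrightarrow> PrGe \<alpha> 0 \<in> axioms"
| P3: "\<alpha> \<in> CO \<Longrightarrow> \<beta> \<in> CO \<Longrightarrow> \<delta> \<in> {0..1} \<Longrightarrow> \<epsilon> \<in> {0..1} \<Longrightarrow> \<delta> + \<epsilon> \<le> 1 \<Longrightarrow>
    ((PrEq \<alpha> \<delta> \<^bold>\<and> PrEq \<beta> \<epsilon> \<^bold>\<and> PrEq (\<alpha> \<^bold>\<and> \<beta>) 0) \<^bold>\<longrightarrow> PrEq (\<alpha> \<^bold>\<or> \<beta>) (\<delta> + \<epsilon>)) \<in> axioms"
| P3b: "\<alpha> \<in> CO \<Longrightarrow> \<beta> \<in> CO \<Longrightarrow> \<epsilon> \<in> {0..1} \<Longrightarrow>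
    ((PrGe \<alpha> \<epsilon> \<^bold>\<and> PrEq (\<alpha> \<^bold>\<and> \<beta>) 0) \<^bold>\<longrightarrow> PrLe \<beta> (1 - \<epsilon>)) \<in> axioms"
| P4: "\<alpha> \<in> CO \<Longrightarrow> \<delta> \<in> {0..1} \<Longrightarrow> \<epsilon> \<in> {0..1} \<Longrightarrow> \<delta> > \<epsilon> \<Longrightarrow>
    (PrLe \<alpha> \<epsilon> \<^bold>\<longrightarrow> PrLt \<alpha> \<delta>) \<in> axioms"
| P5: "\<alpha> \<in> CO \<Longrightarrow> \<epsilon> \<in> {0..1} \<Longrightarrow> (PrLt \<alpha> \<epsilon> \<^bold>\<longrightarrow> PrLe \<alpha> \<epsilon>) \<in> axioms"
| P6: "\<alpha> \<in> CO \<Longrightarrow> \<beta> \<in> CO \<Longrightarrow> \<epsilon> \<in> {0..1} \<Longrightarrow>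
    (PrEq (\<alpha> \<^bold>\<equiv> \<beta>) 1 \<^bold>\<longrightarrow> (PrEq \<alpha> \<epsilon> \<^bold>\<longrightarrow> PrEq \<beta> \<epsilon>)) \<in> axioms"
| P6b: "\<alpha> \<in> CO \<Longrightarrow> \<beta> \<in> CO \<Longrightarrow> \<epsilon> \<in> {0..1} \<Longrightarrow>
    (PrEq (\<alpha> \<^bold>\<supset> \<beta>) 1 \<^bold>\<longrightarrow> (PrEq \<alpha> \<epsilon> \<^bold>\<longrightarrow> PrGe \<beta> \<epsilon>)) \<in> axioms"

| CP1: "\<alpha> \<in> CO \<Longrightarrow> \<beta> \<in> CO \<Longrightarrow> \<delta> \<in> {0..1} \<Longrightarrow> \<epsilon> \<in> {0..1} \<Longrightarrow> \<delta> \<ge> \<epsilon> \<Longrightarrow>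
    ((PrEq \<alpha> \<delta> \<^bold>\<and> PrEq \<beta> \<epsilon>) \<^bold>\<longrightarrow> PrGeP \<alpha> \<beta>) \<in> axioms"
| CP2: "\<alpha> \<in> CO \<Longrightarrow> \<beta> \<in> CO \<Longrightarrow> \<delta> \<in> {0..1} \<Longrightarrow> \<epsilon> \<in> {0..1} \<Longrightarrow> \<delta> > \<epsilon> \<Longrightarrow>
    ((PrEq \<alpha> \<delta> \<^bold>\<and> PrEq \<beta> \<epsilon>) \<^bold>\<longrightarrow> PrGtP \<alpha> \<beta>) \<in> axioms"

| O1: "\<alpha> \<in> CO \<Longrightarrow> \<psi> \<in> PCO \<Longrightarrow> (PrEq \<alpha> 0 \<^bold>\<longrightarrow> (\<alpha> \<^bold>\<supset> \<psi>)) \<in> axioms"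
| O1b: "\<alpha> \<in> CO \<Longrightarrow> ((\<alpha> \<^bold>\<supset> \<^bold>\<bottom>) \<^bold>\<longrightarrow> PrEq \<alpha> 0) \<in> axioms"
  \<comment> \<open>for \<open>\<epsilon> > \<delta>\<close> the quotient would not be a value in the unit interval\<close>
| O2: "\<alpha> \<in> CO \<Longrightarrow> \<beta> \<in> CO \<Longrightarrow> \<delta> \<in> {0..1} \<Longrightarrow> \<epsilon> \<in> {0..1} \<Longrightarrow> \<delta> \<noteq> 0 \<Longrightarrow> \<epsilon> \<le> \<delta> \<Longrightarrow>
    ((PrEq \<alpha> \<delta> \<^bold>\<and> PrEq (\<alpha> \<^bold>\<and> \<beta>) \<epsilon>) \<^bold>\<longrightarrow> (\<alpha> \<^bold>\<supset> PrEq \<beta> (\<epsilon> / \<delta>))) \<in> axioms"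
| O3: "\<alpha> \<in> CO \<Longrightarrow> \<beta> \<in> CO \<Longrightarrow> \<delta> \<in> {0..1} \<Longrightarrow> \<epsilon> \<in> {0..1} \<Longrightarrow> \<epsilon> \<noteq> 0 \<Longrightarrow>
    ((\<alpha> \<^bold>\<supset> PrEq \<beta> \<epsilon>) \<^bold>\<longrightarrow> (PrEq \<alpha> \<delta> \<^bold>\<longleftrightarrow> PrEq (\<alpha> \<^bold>\<and> \<beta>) (\<epsilon> * \<delta>))) \<in> axioms"
| O4: "\<alpha> \<in> CO \<Longrightarrow> \<psi> \<in> PCO \<Longrightarrow> ((\<alpha> \<^bold>\<supset> \<psi>) \<^bold>\<longrightarrow> (\<alpha> \<^bold>\<longrightarrow> \<psi>)) \<in> axioms"
| O5_conj: "\<alpha> \<in> CO \<Longrightarrow> \<psi> \<in> PCO \<Longrightarrow> \<chi> \<in> PCO \<Longrightarrow>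
    ((\<alpha> \<^bold>\<supset> (\<psi> \<^bold>\<and> \<chi>)) \<^bold>\<longleftrightarrow> ((\<alpha> \<^bold>\<supset> \<psi>) \<^bold>\<and> (\<alpha> \<^bold>\<supset> \<chi>))) \<in> axioms"
| O5_gdisj: "\<alpha> \<in> CO \<Longrightarrow> \<psi> \<in> PCO \<Longrightarrow> \<chi> \<in> PCO \<Longrightarrow>
    ((\<alpha> \<^bold>\<supset> (\<psi> \<^bold>\<squnion> \<chi>)) \<^bold>\<longleftrightarrow> ((\<alpha> \<^bold>\<supset> \<psi>) \<^bold>\<squnion> (\<alpha> \<^bold>\<supset> \<chi>))) \<in> axioms"
| O5_obs: "\<alpha> \<in> CO \<Longrightarrow> \<beta> \<in> CO \<Longrightarrow> \<chi> \<in> PCO \<Longrightarrow>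
    ((\<alpha> \<^bold>\<supset> (\<beta> \<^bold>\<supset> \<chi>)) \<^bold>\<longleftrightarrow> ((\<alpha> \<^bold>\<and> \<beta>) \<^bold>\<supset> \<chi>)) \<in> axioms"

| A1: "set Ys \<subseteq> set (Dom \<sigma>) \<Longrightarrow> y \<in> set (tuples Ys) \<Longrightarrow> y' \<in> set (tuples Ys) \<Longrightarrow> y \<noteq> y' \<Longrightarrow>
    (eqs (zip Ys y) \<^bold>\<longrightarrow> neqs (zip Ys y')) \<in> axioms"
| A2: "X \<in> set (Dom \<sigma>) \<Longrightarrow> x \<in> set (Ran \<sigma> X) \<Longrightarrow>
    ((X \<^bold>\<noteq> x) \<^bold>\<longleftrightarrow> ((X \<^bold>= x) \<^bold>\<supset> \<^bold>\<bottom>)) \<in> axioms"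
| A3: "set Ys \<subseteq> set (Dom \<sigma>) \<Longrightarrow> big_disj [eqs (zip Ys y). y \<leftarrow> tuples Ys] \<in> axioms"

| C1: "xs \<in> assignments \<Longrightarrow> \<psi> \<in> PCO \<Longrightarrow> \<chi> \<in> PCO \<Longrightarrow>
    ((xs \<^bold>\<box> (\<psi> \<^bold>\<and> \<chi>)) \<^bold>\<longleftrightarrow> ((xs \<^bold>\<box> \<psi>) \<^bold>\<and> (xs \<^bold>\<box> \<chi>))) \<in> axioms"
| C2: "xs \<in> assignments \<Longrightarrow> \<psi> \<in> PCO \<Longrightarrow> \<chi> \<in> PCO \<Longrightarrow>
    ((xs \<^bold>\<box> (\<psi> \<^bold>\<squnion> \<chi>)) \<^bold>\<longleftrightarrow> ((xs \<^bold>\<box> \<psi>) \<^bold>\<squnion> (xs \<^bold>\<box> \<chi>))) \<in> axioms"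
| C3: "xs \<in> assignments \<Longrightarrow> \<alpha> \<in> CO \<Longrightarrow> \<chi> \<in> PCO \<Longrightarrow>
    ((xs \<^bold>\<box> (\<alpha> \<^bold>\<supset> \<chi>)) \<^bold>\<longleftrightarrow> ((xs \<^bold>\<box> \<alpha>) \<^bold>\<supset> (xs \<^bold>\<box> \<chi>))) \<in> axioms"
| C4: "xs \<in> assignments \<Longrightarrow> ys \<in> assignments \<Longrightarrow> consistent xs \<Longrightarrow> \<chi> \<in> PCO \<Longrightarrow>
    ((xs \<^bold>\<box> (ys \<^bold>\<box> \<chi>)) \<^bold>\<longrightarrow>
     (([(X, x) \<leftarrow> xs. X \<notin> fst ` set ys] @ ys) \<^bold>\<box> \<chi>)) \<in> axioms"
| C4b: "xs \<in> assignments \<Longrightarrow> ys \<in> assignments \<Longrightarrow> \<chi> \<in> PCO \<Longrightarrow>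
    (((xs @ ys) \<^bold>\<box> \<chi>) \<^bold>\<longrightarrow> (xs \<^bold>\<box> (ys \<^bold>\<box> \<chi>))) \<in> axioms"
| C5: "xs \<in> assignments \<Longrightarrow> consistent xs \<Longrightarrow> \<psi> \<in> PCO \<Longrightarrow>
    ((xs \<^bold>\<box> \<^bold>\<bottom>) \<^bold>\<longrightarrow> \<psi>) \<in> axioms"
| C6: "xs \<in> assignments \<Longrightarrow> Y \<in> set (Dom \<sigma>) \<Longrightarrow> y \<in> set (Ran \<sigma> Y) \<Longrightarrow>
    ((xs @ [(Y, y)]) \<^bold>\<box> (Y \<^bold>= y)) \<in> axioms"
| C7: "xs \<in> assignments \<Longrightarrow> \<gamma> \<in> PCO \<Longrightarrow> cf_free \<gamma> \<Longrightarrow>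
    ((eqs xs \<^bold>\<and> \<gamma>) \<^bold>\<longrightarrow> (xs \<^bold>\<box> \<gamma>)) \<in> axioms"
| C8_ge: "xs \<in> assignments \<Longrightarrow> \<alpha> \<in> CO \<Longrightarrow> \<epsilon> \<in> {0..1} \<Longrightarrow>
    ((xs \<^bold>\<box> PrGe \<alpha> \<epsilon>) \<^bold>\<longleftrightarrow> PrGe (xs \<^bold>\<box> \<alpha>) \<epsilon>) \<in> axioms"
| C8_gt: "xs \<in> assignments \<Longrightarrow> \<alpha> \<in> CO \<Longrightarrow> \<epsilon> \<in> {0..1} \<Longrightarrow>
    ((xs \<^bold>\<box> PrGt \<alpha> \<epsilon>) \<^bold>\<longleftrightarrow> PrGt (xs \<^bold>\<box> \<alpha>) \<epsilon>) \<in> axioms"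
| C8b_ge: "xs \<in> assignments \<Longrightarrow> \<alpha> \<in> CO \<Longrightarrow> \<beta> \<in> CO \<Longrightarrow>
    ((xs \<^bold>\<box> PrGeP \<alpha> \<beta>) \<^bold>\<longleftrightarrow> PrGeP (xs \<^bold>\<box> \<alpha>) (xs \<^bold>\<box> \<beta>)) \<in> axioms"
| C8b_gt: "xs \<in> assignments \<Longrightarrow> \<alpha> \<in> CO \<Longrightarrow> \<beta> \<in> CO \<Longrightarrow>
    ((xs \<^bold>\<box> PrGtP \<alpha> \<beta>) \<^bold>\<longleftrightarrow> PrGtP (xs \<^bold>\<box> \<alpha>) (xs \<^bold>\<box> \<beta>)) \<in> axioms"
| C9: "Y \<in> set (Dom \<sigma>) \<Longrightarrow> w \<in> set (tuples (W1 Y)) \<Longrightarrow>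
    (End Y \<^bold>\<longrightarrow> (zip (W1 Y) w \<^bold>\<box> big_gdisj [Y \<^bold>= y. y \<leftarrow> Ran \<sigma> Y])) \<in> axioms"
| C10: "Y \<in> set (Dom \<sigma>) \<Longrightarrow> y \<in> set (Ran \<sigma> Y) \<Longrightarrow> w \<in> set (tuples (W1 Y)) \<Longrightarrow>
    (compl (End Y) \<^bold>\<longrightarrow> ((Y \<^bold>= y) \<^bold>\<supset> (zip (W1 Y) w \<^bold>\<box> (Y \<^bold>= y)))) \<in> axioms"
  \<comment> \<open>The \<open>X\<^sub>i\<close> are distinct variables: \<open>X \<^bold>\<leadsto> X\<close> is valid whenever \<open>X\<close> has two values,
      so that \<open>X \<^bold>\<leadsto> X \<^bold>\<longrightarrow> compl (X \<^bold>\<leadsto> X)\<close> would make the system inconsistent.\<close>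
| C11: "set Xs \<subseteq> set (Dom \<sigma>) \<Longrightarrow> distinct Xs \<Longrightarrow> length Xs > 1 \<Longrightarrow>
    (big_conj (map2 affects (butlast Xs) (tl Xs)) \<^bold>\<longrightarrow> compl (last Xs \<^bold>\<leadsto> hd Xs)) \<in> axioms"

text \<open>The rules that apply to arbitrary formulas; \<open>E\<close> is the set of available premises.\<close>

inductive rule :: "('v, 'a) fm set \<Rightarrow> ('v, 'a) fm \<Rightarrow> bool" for E where
  MP: "\<psi> \<in> E \<Longrightarrow> (\<psi> \<^bold>\<longrightarrow> \<chi>) \<in> E \<Longrightarrow> \<psi> \<in> PCO \<Longrightarrow> \<chi> \<in> PCO \<Longrightarrow> rule E \<chi>"
| bot_omega: "\<psi> \<in> PCO \<Longrightarrow> \<alpha> \<in> CO \<Longrightarrow>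
    (\<And>\<epsilon>. \<epsilon> \<in> {0..1} \<Longrightarrow> (\<psi> \<^bold>\<longrightarrow> PrNe \<alpha> \<epsilon>) \<in> E) \<Longrightarrow> rule E (\<psi> \<^bold>\<longrightarrow> \<^bold>\<bottom>)"
| obs_omega: "\<psi> \<in> PCO \<Longrightarrow> \<alpha> \<in> CO \<Longrightarrow> \<beta> \<in> CO \<Longrightarrow> \<delta> \<in> {0..1} \<Longrightarrow>
    (\<And>\<epsilon>. \<epsilon> \<in> {0<..1} \<Longrightarrow> (\<psi> \<^bold>\<longrightarrow> (PrEq (\<alpha> \<^bold>\<and> \<beta>) (\<delta> * \<epsilon>) \<^bold>\<longleftrightarrow> PrEq \<alpha> \<epsilon>)) \<in> E) \<Longrightarrow>
    rule E (\<psi> \<^bold>\<longrightarrow> (\<alpha> \<^bold>\<supset> PrEq \<beta> \<delta>))"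

text \<open>The rules that apply only to theorems.\<close>

inductive thm_rule :: "('v, 'a) fm set \<Rightarrow> ('v, 'a) fm \<Rightarrow> bool" for E where
  Rep: "\<phi> \<in> PCO \<Longrightarrow> \<theta> \<in> PCO \<Longrightarrow> \<theta>' \<in> PCO \<Longrightarrow> \<phi> \<in> E \<Longrightarrow> (\<theta> \<^bold>\<longleftrightarrow> \<theta>') \<in> E \<Longrightarrow>
    repl \<theta> \<theta>' \<phi> \<in> PCO \<Longrightarrow> thm_rule E (repl \<theta> \<theta>' \<phi>)"
| Mon_obs: "\<alpha> \<in> CO \<Longrightarrow> \<psi> \<in> PCO \<Longrightarrow> \<chi> \<in> PCO \<Longrightarrow> (\<psi> \<^bold>\<longrightarrow> \<chi>) \<in> E \<Longrightarrow>
    thm_rule E ((\<alpha> \<^bold>\<supset> \<psi>) \<^bold>\<longrightarrow> (\<alpha> \<^bold>\<supset> \<chi>))"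
| imp_to_obs: "\<alpha> \<in> CO \<Longrightarrow> \<psi> \<in> PCO \<Longrightarrow> (\<alpha> \<^bold>\<longrightarrow> \<psi>) \<in> E \<Longrightarrow> thm_rule E (\<alpha> \<^bold>\<supset> \<psi>)"
| Mon_cf: "xs \<in> assignments \<Longrightarrow> \<psi> \<in> PCO \<Longrightarrow> \<chi> \<in> PCO \<Longrightarrow> (\<psi> \<^bold>\<longrightarrow> \<chi>) \<in> E \<Longrightarrow>
    thm_rule E ((xs \<^bold>\<box> \<psi>) \<^bold>\<longrightarrow> (xs \<^bold>\<box> \<chi>))"

text \<open>
  A sequence of formulas indexed by the ordinals below a countable ordinal is given by a well-order
  \<open>r\<close> of a set of natural numbers and a labelling \<open>s\<close>. A sequence indexed by the ordinals \<open>\<le> \<kappa>\<close> is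
  one where \<open>r\<close> has a greatest element. \<open>Th\<close> is the set of formulas to which the rules for theorems
  may be applied.
\<close>

definition derivation ::
  "('v, 'a) fm set \<Rightarrow> ('v, 'a) fm set \<Rightarrow> nat rel \<Rightarrow> (nat \<Rightarrow> ('v, 'a) fm) \<Rightarrow> bool" where
  "derivation Th \<Gamma> r s \<longleftrightarrow> Well_order r \<and>
     (\<forall>i \<in> Field r. s i \<in> PCO \<and>
        (s i \<in> axioms \<or> s i \<in> \<Gamma> \<or> rule (s ` underS r i) (s i)
          \<or> thm_rule (s ` underS r i \<inter> Th) (s i)))"

definition derives_using :: "('v, 'a) fm set \<Rightarrow> ('v, 'a) fm set \<Rightarrow> ('v, 'a) fm \<Rightarrow> bool" where
  "derives_using Th \<Gamma> \<phi> \<longleftrightarrow>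
     (\<exists>r s. derivation Th \<Gamma> r s \<and> (\<exists>k \<in> Field r. (\<forall>i \<in> Field r. (i, k) \<in> r) \<and> s k = \<phi>))"

text \<open>
  In a derivation from \<open>\<emptyset>\<close> every term is itself derivable from \<open>\<emptyset>\<close> (cut the sequence off at that
  term), so there the restriction to theorems is void; see \<open>derives_empty_iff\<close>.
\<close>

definition theorems :: "('v, 'a) fm set" where
  "theorems = {\<phi>. derives_using UNIV {} \<phi>}"

definition derives :: "('v, 'a) fm set \<Rightarrow> ('v, 'a) fm \<Rightarrow> bool"  (infix "\<^bold>\<turnstile>" 20) where
  "(\<Gamma> \<^bold>\<turnstile> \<phi>) \<longleftrightarrow> derives_using theorems \<Gamma> \<phi>"

section \<open>Basic facts\<close>

lemma CO_subset_PCO: "CO \<subseteq> PCO"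
proof
  fix \<alpha> assume "\<alpha> \<in> CO"
  then show "\<alpha> \<in> PCO" by induction (auto intro: PCO.intros)
qed

lemma bot_neq_top [simp]: "\<^bold>\<bottom> \<noteq> \<^bold>\<top>" "\<^bold>\<top> \<noteq> \<^bold>\<bottom>"
  by (simp_all add: top_def bot_def)

lemma un_neg_neg [simp]: "un_neg (\<^bold>\<not> \<alpha>) = Some \<alpha>"
  by (simp add: un_neg_def neg_def)

lemma compl_abbreviations:
  "compl \<^bold>\<bottom> = \<^bold>\<top>"
  "compl \<^bold>\<top> = \<^bold>\<bottom>"
  "compl (PrLt \<alpha> \<epsilon>) = PrGe \<alpha> \<epsilon>"
  "compl (PrLe \<alpha> \<epsilon>) = PrGt \<alpha> \<epsilon>"
  "compl (PrEq \<alpha> \<epsilon>) = PrNe \<alpha> \<epsilon>"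
  "compl (PrNe \<alpha> \<epsilon>) = PrEq \<alpha> \<epsilon>"
  by (simp_all add: PrLt_def PrLe_def PrEq_def PrNe_def un_PrEq_def un_PrNe_def)
     (simp_all add: top_def bot_def)

lemma thm_rule_mono: "thm_rule E \<phi> \<Longrightarrow> E \<subseteq> E' \<Longrightarrow> thm_rule E' \<phi>"
  by (induction rule: thm_rule.induct) (blast intro: thm_rule.intros)+

lemma derivation_truncate:
  assumes d: "derivation Th \<Gamma> r s" and k: "k \<in> Field r"
  shows "derives_using Th \<Gamma> (s k)"
proof -
  have wo: "Well_order r" using d by (simp add: derivation_def)
  then have w: "wo_rel r" by (simp add: wo_rel_def)
  have refl: "Refl r" and trans: "trans r"
    using wo_rel.REFL[OF w] wo_rel.TRANS[OF w] by auto
  define r' where "r' = Restr r (under r k)"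
  have wo': "Well_order r'" unfolding r'_def by (rule Well_order_Restr[OF wo])
  have kk: "(k, k) \<in> r" using refl k by (simp add: refl_on_def)
  have fld: "Field r' = under r k"
    unfolding r'_def using wo_rel.under_ofilter[OF w] wo Field_Restr_ofilter by blast
  have us: "underS r' i = underS r i" if "i \<in> under r k" for i
    using that trans unfolding r'_def underS_def under_def by (auto dest: transD)
  have sub: "under r k \<subseteq> Field r" by (auto simp: under_def Field_def)
  have "derivation Th \<Gamma> r' s"
    using d wo' fld us sub unfolding derivation_def by auto
  moreover have "k \<in> Field r'" using kk fld by (simp add: under_def)
  moreover have "\<forall>i \<in> Field r'. (i, k) \<in> r'"
    unfolding fld using kk by (auto simp: r'_def under_def)
  ultimately show ?thesis unfolding derives_using_def by blast
qed

lemma derives_empty_iff: "({} \<^bold>\<turnstile> \<phi>) \<longleftrightarrow> \<phi> \<in> theorems"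
proof
  assume "{} \<^bold>\<turnstile> \<phi>"
  then obtain r s k where d: "derivation theorems {} r s"
    and k: "k \<in> Field r" "\<forall>i \<in> Field r. (i, k) \<in> r" "s k = \<phi>"
    unfolding derives_def derives_using_def by blast
  have "derivation UNIV {} r s"
    using d unfolding derivation_def by (auto intro: thm_rule_mono)
  then show "\<phi> \<in> theorems" using k unfolding theorems_def derives_using_def by blast
next
  assume "\<phi> \<in> theorems"
  then obtain r s k where d: "derivation UNIV {} r s"
    and k: "k \<in> Field r" "\<forall>i \<in> Field r. (i, k) \<in> r" "s k = \<phi>"
    unfolding theorems_def derives_using_def by blast
  have thms: "s i \<in> theorems" if "i \<in> Field r" for i
    using derivation_truncate[OF d that] by (simp add: theorems_def)
  have "underS r i \<subseteq> Field r" for i by (auto simp: underS_def Field_def)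
  then have "s ` underS r i \<inter> theorems = s ` underS r i" for i
    using thms by blast
  then have "derivation theorems {} r s"
    using d unfolding derivation_def by simp
  then show "{} \<^bold>\<turnstile> \<phi>" using k unfolding derives_def derives_using_def by blast
qed

end

end

theory Submission
  imports Defs "HOL-Library.Countable_Set"
begin

text \<open>
  Induction along a derivation of \<open>\<psi>\<close> from \<open>\<Gamma> \<union> {\<phi>}\<close> turns each line \<open>\<chi>\<close> into \<open>\<Gamma> \<^bold>\<turnstile> \<phi> \<^bold>\<longrightarrow> \<chi>\<close>. The
  rules for theorems only ever produce theorems, which do not depend on the premise \<open>\<phi>\<close>. The
  infinitary rules have a side formula \<open>\<chi>\<close> in their antecedent and go through with \<open>\<phi> \<^bold>\<and> \<chi>\<close> in its
  place. Since a line may depend on infinitely many earlier ones, one needs that countably many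
  derivations can be strung together into a single one, whose length is still countable.
\<close>

section \<open>Concatenation of well-orders\<close>

text \<open>\<open>block_sum r\<close> is the ordinal sum of the \<open>r n\<close>, with a greatest element \<open>None\<close> on top.\<close>

fun block_le :: "(nat \<Rightarrow> 'i rel) \<Rightarrow> (nat \<times> 'i) option \<Rightarrow> (nat \<times> 'i) option \<Rightarrow> bool" where
  "block_le r x None \<longleftrightarrow> True"
| "block_le r None (Some y) \<longleftrightarrow> False"
| "block_le r (Some (n, i)) (Some (m, j)) \<longleftrightarrow> n < m \<or> n = m \<and> (i, j) \<in> r n"

definition block_sum :: "(nat \<Rightarrow> 'i rel) \<Rightarrow> (nat \<times> 'i) option rel" where
  "block_sum r = {(x, y). {x, y} \<subseteq> insert None (Some ` Sigma UNIV (\<lambda>n. Field (r n)))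
     \<and> block_le r x y}"

lemma block_sum_simps [simp]:
  "(x, None) \<in> block_sum r \<longleftrightarrow> x = None \<or> (\<exists>n. \<exists>i \<in> Field (r n). x = Some (n, i))"
  "(None, Some y) \<notin> block_sum r"
  "(Some (n, i), Some (m, j)) \<in> block_sum r \<longleftrightarrow>
     i \<in> Field (r n) \<and> j \<in> Field (r m) \<and> (n < m \<or> n = m \<and> (i, j) \<in> r n)"
  by (auto simp: block_sum_def)

lemma Field_block_sum: "Field (block_sum r) = insert None (Some ` Sigma UNIV (\<lambda>n. Field (r n)))"
proof (intro equalityI subsetI)
  fix x assume "x \<in> insert None (Some ` Sigma UNIV (\<lambda>n. Field (r n)))"
  then have "(x, None) \<in> block_sum r" by auto
  then show "x \<in> Field (block_sum r)" by (rule FieldI1)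
qed (auto simp: Field_def block_sum_def)

text \<open>The order properties other than well-foundedness reduce to a comparison of block numbers
  and, within one block, to the same property of \<open>r n\<close>. Well-foundedness is that of a
  lexicographic order, with one more point on top.\<close>

lemma Well_order_block_sum:
  assumes wo: "\<And>n. Well_order (r n)"
  shows "Well_order (block_sum r)"
proof -
  let ?R = "block_sum r"
  have refl: "(i, i) \<in> r n" if "i \<in> Field (r n)" for n i
    using wo[of n] that
    by (auto simp: well_order_on_def linear_order_on_def partial_order_on_def preorder_on_def
        refl_on_def)
  have trans: "trans (r n)" and antisym: "antisym (r n)" and total: "Total (r n)"
    and wf: "wf (r n - Id)" for n
    using wo[of n]
    by (auto simp: well_order_on_def linear_order_on_def partial_order_on_def preorder_on_def)
  have F: "x = None \<or> (\<exists>n. \<exists>i \<in> Field (r n). x = Some (n, i))" if "x \<in> Field ?R" for x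
    using that by (auto simp: Field_block_sum)
  have "Refl ?R"
    by (rule refl_onI) (use F refl in \<open>auto simp: Field_block_sum\<close>)
  moreover have "trans ?R"
  proof (rule transI)
    fix x y z assume "(x, y) \<in> ?R" "(y, z) \<in> ?R"
    then show "(x, z) \<in> ?R"
      by (cases x; cases y; cases z) (auto dest: transD[OF trans])
  qed
  moreover have "antisym ?R"
  proof (rule antisymI)
    fix x y assume "(x, y) \<in> ?R" "(y, x) \<in> ?R"
    then show "x = y"
      by (cases x; cases y) (auto dest: antisymD[OF antisym])
  qed
  moreover have "Total ?R"
  proof (rule total_onI)
    fix x y assume xy: "x \<in> Field ?R" "y \<in> Field ?R" "x \<noteq> y"
    show "(x, y) \<in> ?R \<or> (y, x) \<in> ?R"
      using F[OF xy(1)] F[OF xy(2)] xy(3) total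
      by (auto simp: total_on_def) (metis linorder_neqE_nat)
  qed
  moreover have "wf (?R - Id)"
  proof (rule wfUNIVI)
    fix P x assume step: "\<forall>x. (\<forall>y. (y, x) \<in> ?R - Id \<longrightarrow> P y) \<longrightarrow> P x"
    \<comment> \<open>The outer induction is on the block number and the inner one along
      \<open>r n\<close>. An \<open>i\<close> outside \<open>Field (r n)\<close> has no predecessor
      in the sum, so it needs no separate treatment.\<close>
    have some: "P (Some (n, i))" for n i
    proof (induction n arbitrary: i rule: less_induct)
      case (less n)
      show ?case
      proof (induction i rule: wf_induct_rule[OF wf[of n]])
        case (1 i)
        have "P y" if "(y, Some (n, i)) \<in> ?R - Id" for y
          using that by (cases y) (auto intro: 1 less)
        then show ?case using step by blast
      qed
    qed
    have "P y" if "(y, None) \<in> ?R - Id" for y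
      using that some by auto
    then have "P None" using step by blast
    with some show "P x" by (cases x) auto
  qed
  ultimately show ?thesis
    by (auto simp: well_order_on_def linear_order_on_def partial_order_on_def preorder_on_def
        refl_on_def intro: FieldI1 FieldI2)
qed

context signature
begin

section \<open>Combining derivations\<close>

lemma rule_mono: "rule E \<phi> \<Longrightarrow> E \<subseteq> E' \<Longrightarrow> rule E' \<phi>"
  by (induction rule: rule.induct) (blast intro: rule.intros)+

text \<open>Justification of a single line, with \<open>E\<close> the set of formulas on earlier
  lines. Stated without the well-order it is monotone in \<Gamma> and \<open>E\<close>, so a line
  stays justified when its derivation is embedded in a longer one.\<close>

definition step :: "('v, 'a) fm set \<Rightarrow> ('v, 'a) fm set \<Rightarrow> ('v, 'a) fm \<Rightarrow> bool" where
  "step \<Gamma> E \<phi> \<longleftrightarrow> \<phi> \<in> PCO \<and>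
     (\<phi> \<in> axioms \<or> \<phi> \<in> \<Gamma> \<or> rule E \<phi> \<or> thm_rule (E \<inter> theorems) \<phi>)"

lemma step_mono: "step \<Gamma> E \<phi> \<Longrightarrow> \<Gamma> \<subseteq> \<Gamma>' \<Longrightarrow> E \<subseteq> E' \<Longrightarrow> step \<Gamma>' E' \<phi>"
  unfolding step_def by (meson Int_mono order_refl rule_mono subsetD thm_rule_mono)

lemma derivation_iff_step:
  "derivation theorems \<Gamma> r s \<longleftrightarrow> Well_order r \<and> (\<forall>i \<in> Field r. step \<Gamma> (s ` underS r i) (s i))"
  unfolding derivation_def step_def by blast

lemma derives_mono: "\<Gamma> \<^bold>\<turnstile> \<phi> \<Longrightarrow> \<Gamma> \<subseteq> \<Gamma>' \<Longrightarrow> \<Gamma>' \<^bold>\<turnstile> \<phi>"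
  unfolding derives_def derives_using_def derivation_iff_step by (meson step_mono order_refl)

text \<open>Derivations are indexed by natural numbers, whereas a block sum lives on
  \<open>(nat \<times> nat) option\<close>. The injection \<open>to_nat\<close> carries the
  well-order over, and \<open>from_nat\<close> recovers the labels.\<close>

lemma derives_countable_index:
  fixes r :: "'i::countable rel" and s :: "'i \<Rightarrow> ('v, 'a) fm"
  assumes wo: "Well_order r" and steps: "\<And>i. i \<in> Field r \<Longrightarrow> step \<Gamma> (s ` underS r i) (s i)"
    and k: "k \<in> Field r" "\<And>i. i \<in> Field r \<Longrightarrow> (i, k) \<in> r"
  shows "\<Gamma> \<^bold>\<turnstile> s k"
proof -
  let ?R = "dir_image r (to_nat :: 'i \<Rightarrow> nat)" and ?s = "s \<circ> (from_nat :: nat \<Rightarrow> 'i)"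
  have "Well_order ?R"
    by (rule Well_order_dir_image[OF wo]) (simp add: inj_on_def)
  moreover have F: "Field ?R = to_nat ` Field r"
    by (rule dir_image_Field)
  moreover have "step \<Gamma> (?s ` underS ?R (to_nat i)) (?s (to_nat i))" if "i \<in> Field r" for i
  proof -
    \<comment> \<open>By monotonicity of \<open>step\<close>, this inclusion suffices to justify the
      transported line.\<close>
    have "s ` underS r i \<subseteq> ?s ` underS ?R (to_nat i)"
    proof
      fix \<chi> assume "\<chi> \<in> s ` underS r i"
      then obtain j where j: "\<chi> = s j" "j \<in> underS r i" by blast
      then have "to_nat j \<in> underS ?R (to_nat i)"
        by (auto simp: underS_def dir_image_def)
      then show "\<chi> \<in> ?s ` underS ?R (to_nat i)"
        using j(1) by force
    qed
    then show ?thesis using steps[OF that] by (auto intro: step_mono)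
  qed
  ultimately have "derivation theorems \<Gamma> ?R ?s"
    unfolding derivation_iff_step by simp
  moreover have "to_nat k \<in> Field ?R" "?s (to_nat k) = s k"
    using k(1) F by auto
  moreover have "\<forall>j \<in> Field ?R. (j, to_nat k) \<in> ?R"
    using k(2) F by (auto simp: dir_image_def)
  ultimately show ?thesis unfolding derives_def derives_using_def by blast
qed

text \<open>The derivations of the \<open>e n\<close> are laid one after another and \<phi> is
  placed on top. The formula \<open>e n\<close> occurs in block \<open>n\<close> at position
  \<open>k n\<close>, hence below \<phi>.\<close>

lemma derives_step_seq:
  assumes e: "\<And>n::nat. \<Gamma> \<^bold>\<turnstile> e n" and step: "step \<Gamma> (range e) \<phi>"
  shows "\<Gamma> \<^bold>\<turnstile> \<phi>"
proof -
  have "\<forall>n. \<exists>r s k. derivation theorems \<Gamma> r s \<and> k \<in> Field r \<and> s k = e n"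
    using e unfolding derives_def derives_using_def by blast
  then obtain r s k where d: "\<And>n. derivation theorems \<Gamma> (r n) (s n)"
    and k: "\<And>n. k n \<in> Field (r n)" "\<And>n. s n (k n) = e n"
    by metis
  let ?R = "block_sum r"
  let ?s = "case_option \<phi> (\<lambda>(n, i). s n i)"
  have "Well_order ?R"
    by (rule Well_order_block_sum) (use d in \<open>simp add: derivation_iff_step\<close>)
  moreover have "step \<Gamma> (?s ` underS ?R x) (?s x)" if x_Field: "x \<in> Field ?R" for x
  proof (cases x)
    case None
    have "range e \<subseteq> ?s ` underS ?R None"
    proof
      fix \<chi> assume "\<chi> \<in> range e"
      then obtain n where "\<chi> = e n" by blast
      then have "\<chi> = ?s (Some (n, k n))" using k(2) by simp
      moreover have "Some (n, k n) \<in> underS ?R None"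
        using k(1) by (simp add: underS_def)
      ultimately show "\<chi> \<in> ?s ` underS ?R None" by blast
    qed
    then show ?thesis using step None by (auto intro: step_mono)
  next
    case (Some y)
    then obtain n i where x: "x = Some (n, i)" and i: "i \<in> Field (r n)"
      using x_Field Some by (auto simp: Field_block_sum)
    \<comment> \<open>Predecessors within the own block survive in the sum; earlier blocks can only
      add further available premises.\<close>
    have "s n ` underS (r n) i \<subseteq> ?s ` underS ?R x"
    proof
      fix \<chi> assume "\<chi> \<in> s n ` underS (r n) i"
      then obtain j where j: "\<chi> = ?s (Some (n, j))" "j \<in> underS (r n) i" by auto
      then have "Some (n, j) \<in> underS ?R x"
        using i x by (auto simp: underS_def Field_def)
      then show "\<chi> \<in> ?s ` underS ?R x" using j(1) by blast
    qed
    moreover have "step \<Gamma> (s n ` underS (r n) i) (s n i)"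
      using d i by (simp add: derivation_iff_step)
    ultimately show ?thesis using x by (auto intro: step_mono)
  qed
  ultimately have "\<Gamma> \<^bold>\<turnstile> ?s None"
    by (rule derives_countable_index) (auto simp: Field_block_sum)
  then show ?thesis by simp
qed

text \<open>The closure property on which everything below rests: countably many derivable premises
  may be used at once, as the two infinitary rules require. It makes well-orders invisible when
  derivations are built.\<close>

lemma derives_step:
  assumes "countable E" and "\<And>\<chi>. \<chi> \<in> E \<Longrightarrow> \<Gamma> \<^bold>\<turnstile> \<chi>" and "step \<Gamma> E \<phi>"
  shows "\<Gamma> \<^bold>\<turnstile> \<phi>"
proof (cases "E = {}")
  case True
  \<comment> \<open>\<open>from_nat_into\<close> enumerates only nonempty sets, so the case without
    premises uses a derivation of one line.\<close>
  define r :: "nat rel" where "r = {(0, 0)}"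
  have F: "Field r = {0}" by (auto simp: r_def Field_def)
  have "Well_order r"
    unfolding F
    by (auto simp: r_def well_order_on_def linear_order_on_def partial_order_on_def
        preorder_on_def refl_on_def trans_def antisym_def total_on_def)
  then have "\<Gamma> \<^bold>\<turnstile> (\<lambda>_. \<phi>) (0 :: nat)"
    by (rule derives_countable_index)
       (use assms(3) True in \<open>auto simp: F r_def intro: step_mono\<close>)
  then show ?thesis .
next
  case False
  show ?thesis
  proof (rule derives_step_seq)
    show "\<Gamma> \<^bold>\<turnstile> from_nat_into E n" for n
      using assms(2) from_nat_into[OF False] by blast
    show "step \<Gamma> (range (from_nat_into E)) \<phi>"
      using assms(3) False by (simp add: assms(1))
  qed
qed

lemma derives_axiom: "\<phi> \<in> axioms \<Longrightarrow> \<phi> \<in> PCO \<Longrightarrow> \<Gamma> \<^bold>\<turnstile> \<phi>"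
  by (rule derives_step[of "{}"]) (auto simp: step_def)

lemma derives_premise: "\<phi> \<in> \<Gamma> \<Longrightarrow> \<phi> \<in> PCO \<Longrightarrow> \<Gamma> \<^bold>\<turnstile> \<phi>"
  by (rule derives_step[of "{}"]) (auto simp: step_def)

lemma derives_MP:
  assumes "\<Gamma> \<^bold>\<turnstile> \<phi>" "\<Gamma> \<^bold>\<turnstile> \<phi> \<^bold>\<longrightarrow> \<psi>" "\<phi> \<in> PCO" "\<psi> \<in> PCO"
  shows "\<Gamma> \<^bold>\<turnstile> \<psi>"
  by (rule derives_step[of "{\<phi>, \<phi> \<^bold>\<longrightarrow> \<psi>}"]) (use assms in \<open>auto simp: step_def intro: rule.MP\<close>)

text \<open>\<open>theorems\<close> is defined by derivations without the restriction on the theorem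
  rules; \<open>derives_empty_iff\<close> turns membership into derivability from the empty set, and
  monotonicity adds the premises.\<close>

lemma derives_theorem: "\<phi> \<in> theorems \<Longrightarrow> \<Gamma> \<^bold>\<turnstile> \<phi>"
  using derives_empty_iff derives_mono by blast

section \<open>Well-formedness and tautologies\<close>

lemma top_in_PCO: "\<^bold>\<top> \<in> PCO" and bot_in_CO: "\<^bold>\<bottom> \<in> CO"
  using X0_in_Dom x0_in_Ran
  by (auto simp: top_def bot_def assignments_def intro!: PCO.intros CO.intros)

lemma neg_in_CO: "\<alpha> \<in> CO \<Longrightarrow> \<^bold>\<not> \<alpha> \<in> CO"
  unfolding neg_def by (intro CO.intros bot_in_CO)

lemma Pr_in_PCO:
  assumes "\<alpha> \<in> CO" "\<epsilon> \<in> {0..1}"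
  shows "PrLe \<alpha> \<epsilon> \<in> PCO" "PrLt \<alpha> \<epsilon> \<in> PCO" "PrEq \<alpha> \<epsilon> \<in> PCO" "PrNe \<alpha> \<epsilon> \<in> PCO"
  using assms neg_in_CO by (auto simp: PrLe_def PrLt_def PrEq_def PrNe_def intro!: PCO.intros)

lemma un_neg_SomeD: "un_neg \<alpha> = Some \<beta> \<Longrightarrow> \<alpha> = \<^bold>\<not> \<beta>"
  by (auto simp: un_neg_def neg_def split: fm.splits if_splits)

lemma un_PrEq_SomeD: "un_PrEq \<phi> = Some (\<alpha>, \<epsilon>) \<Longrightarrow> \<phi> = PrEq \<alpha> \<epsilon>"
  by (auto simp: un_PrEq_def PrEq_def split: fm.splits if_splits)

lemma un_PrNe_SomeD: "un_PrNe \<phi> = Some (\<alpha>, \<epsilon>) \<Longrightarrow> \<phi> = PrNe \<alpha> \<epsilon>"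
  by (auto simp: un_PrNe_def PrNe_def split: fm.splits if_splits)

text \<open>The delicate clauses are those for abbreviations, whose recognised arguments must be
  well formed again. If \<alpha> is \<open>neg \<beta>\<close>, inverting \<open>CO\<close> gives
  \<beta> in \<open>CO\<close>, and 1 - \<epsilon> stays in the unit interval.\<close>

lemma compl_in_PCO: "\<phi> \<in> PCO \<Longrightarrow> compl \<phi> \<in> PCO"
proof (induction rule: PCO.induct)
  case (3 \<alpha> \<epsilon>)
  then show ?case
    by (auto split: option.splits dest!: un_neg_SomeD simp: neg_def
        intro!: PCO.intros Pr_in_PCO elim: CO.cases)
next
  case (4 \<alpha> \<epsilon>)
  then show ?case
    by (auto split: option.splits dest!: un_neg_SomeD simp: neg_def
        intro!: PCO.intros Pr_in_PCO elim: CO.cases)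
next
  case (7 \<phi> \<psi>)
  have "PrNe \<alpha> \<epsilon> \<in> PCO" if "un_PrEq (\<phi> \<^bold>\<and> \<psi>) = Some (\<alpha>, \<epsilon>)" for \<alpha> \<epsilon>
  proof -
    \<comment> \<open>The first conjunct of \<open>PrEq \<alpha> \<epsilon>\<close>; inverting
      \<open>PCO\<close> on it recovers \<alpha> in \<open>CO\<close> and the range of \<epsilon>.
      Case 8 does the same with \<open>PrGt\<close>.\<close>
    have "PrGe \<alpha> \<epsilon> \<in> PCO" using un_PrEq_SomeD[OF that] 7 by (simp add: PrEq_def)
    then show ?thesis by cases (rule Pr_in_PCO)
  qed
  then show ?case using 7 by (auto split: option.splits intro!: PCO.intros)
next
  case (8 \<phi> \<psi>)
  have "PrEq \<alpha> \<epsilon> \<in> PCO" if "un_PrNe (\<phi> \<^bold>\<squnion> \<psi>) = Some (\<alpha>, \<epsilon>)" for \<alpha> \<epsilon>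
  proof -
    have "PrGt \<alpha> \<epsilon> \<in> PCO" using un_PrNe_SomeD[OF that] 8 by (simp add: PrNe_def)
    then show ?thesis by cases (rule Pr_in_PCO)
  qed
  then show ?case using 8 by (auto split: option.splits intro!: PCO.intros)
qed (use top_in_PCO bot_in_CO CO_subset_PCO in
    \<open>auto intro!: PCO.intros Pr_in_PCO intro: CO.intros\<close>)

lemma imp_in_PCO: "\<phi> \<in> PCO \<Longrightarrow> \<psi> \<in> PCO \<Longrightarrow> (\<phi> \<^bold>\<longrightarrow> \<psi>) \<in> PCO"
  unfolding imp_def by (intro PCO.intros compl_in_PCO)

lemma iff_in_PCO: "\<phi> \<in> PCO \<Longrightarrow> \<psi> \<in> PCO \<Longrightarrow> (\<phi> \<^bold>\<longleftrightarrow> \<psi>) \<in> PCO"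
  unfolding iff_def by (intro PCO.intros imp_in_PCO)

lemma inst_PCO_in_PCO: "(\<And>n. s n \<in> PCO) \<Longrightarrow> inst_PCO s p \<in> PCO"
  using top_in_PCO bot_in_CO CO_subset_PCO
  by (induction p) (auto intro: PCO.intros compl_in_PCO imp_in_PCO)

text \<open>T1 asks for a substitution that is well formed at every index, hence the default value
  \<open>top\<close> beyond the list. Since \<open>inst_PCO\<close> sends \<open>PImp\<close> to
  \<open>imp\<close>, simplification turns an instance into the formula wanted.\<close>

lemma derives_taut:
  assumes "tautology p" and "set \<phi>s \<subseteq> PCO"
  shows "\<Gamma> \<^bold>\<turnstile> inst_PCO (\<lambda>n. if n < length \<phi>s then \<phi>s ! n else \<^bold>\<top>) p"
proof -
  have "(if n < length \<phi>s then \<phi>s ! n else \<^bold>\<top>) \<in> PCO" for n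
    using assms(2) top_in_PCO by (auto dest: nth_mem)
  with assms(1) show ?thesis by (intro derives_axiom axioms.T1 inst_PCO_in_PCO)
qed

lemma derives_imp_refl: "\<phi> \<in> PCO \<Longrightarrow> \<Gamma> \<^bold>\<turnstile> \<phi> \<^bold>\<longrightarrow> \<phi>"
  using derives_taut[of "PImp (PVar 0) (PVar 0)" "[\<phi>]" \<Gamma>] by (simp add: tautology_def)

lemma derives_imp_weaken:
  assumes "\<Gamma> \<^bold>\<turnstile> \<psi>" "\<phi> \<in> PCO" "\<psi> \<in> PCO"
  shows "\<Gamma> \<^bold>\<turnstile> \<phi> \<^bold>\<longrightarrow> \<psi>"
proof -
  have "\<Gamma> \<^bold>\<turnstile> \<psi> \<^bold>\<longrightarrow> \<phi> \<^bold>\<longrightarrow> \<psi>"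
    using derives_taut[of "PImp (PVar 1) (PImp (PVar 0) (PVar 1))" "[\<phi>, \<psi>]" \<Gamma>] assms
    by (simp add: tautology_def)
  then show ?thesis using assms by (blast intro: derives_MP imp_in_PCO)
qed

lemma derives_imp_MP:
  assumes "\<Gamma> \<^bold>\<turnstile> \<phi> \<^bold>\<longrightarrow> \<psi>" "\<Gamma> \<^bold>\<turnstile> \<phi> \<^bold>\<longrightarrow> \<psi> \<^bold>\<longrightarrow> \<chi>" and PCO: "\<phi> \<in> PCO" "\<psi> \<in> PCO" "\<chi> \<in> PCO"
  shows "\<Gamma> \<^bold>\<turnstile> \<phi> \<^bold>\<longrightarrow> \<chi>"
proof -
  have "\<Gamma> \<^bold>\<turnstile> (\<phi> \<^bold>\<longrightarrow> \<psi>) \<^bold>\<longrightarrow> (\<phi> \<^bold>\<longrightarrow> \<psi> \<^bold>\<longrightarrow> \<chi>) \<^bold>\<longrightarrow> (\<phi> \<^bold>\<longrightarrow> \<chi>)"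
    using derives_taut[of "PImp (PImp (PVar 0) (PVar 1))
      (PImp (PImp (PVar 0) (PImp (PVar 1) (PVar 2))) (PImp (PVar 0) (PVar 2)))" "[\<phi>, \<psi>, \<chi>]" \<Gamma>] PCO
    by (simp add: tautology_def)
  then have "\<Gamma> \<^bold>\<turnstile> (\<phi> \<^bold>\<longrightarrow> \<psi> \<^bold>\<longrightarrow> \<chi>) \<^bold>\<longrightarrow> (\<phi> \<^bold>\<longrightarrow> \<chi>)"
    by (rule derives_MP[OF assms(1)]) (intro imp_in_PCO PCO)+
  then show ?thesis
    by (rule derives_MP[OF assms(2)]) (intro imp_in_PCO PCO)+
qed

text \<open>Both directions serve the infinitary rules: one merges \<phi> with the side formula in
  each premise, the other separates them again in the conclusion.\<close>

lemma derives_imp_curry: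
  assumes PCO: "\<phi> \<in> PCO" "\<psi> \<in> PCO" "\<chi> \<in> PCO"
  shows "(\<Gamma> \<^bold>\<turnstile> \<phi> \<^bold>\<longrightarrow> \<psi> \<^bold>\<longrightarrow> \<chi>) \<longleftrightarrow> (\<Gamma> \<^bold>\<turnstile> (\<phi> \<^bold>\<and> \<psi>) \<^bold>\<longrightarrow> \<chi>)"
proof
  have "\<Gamma> \<^bold>\<turnstile> (\<phi> \<^bold>\<longrightarrow> \<psi> \<^bold>\<longrightarrow> \<chi>) \<^bold>\<longrightarrow> ((\<phi> \<^bold>\<and> \<psi>) \<^bold>\<longrightarrow> \<chi>)"
    using derives_taut[of "PImp (PImp (PVar 0) (PImp (PVar 1) (PVar 2)))
      (PImp (PAnd (PVar 0) (PVar 1)) (PVar 2))" "[\<phi>, \<psi>, \<chi>]" \<Gamma>] PCO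
    by (simp add: tautology_def)
  then show "\<Gamma> \<^bold>\<turnstile> (\<phi> \<^bold>\<and> \<psi>) \<^bold>\<longrightarrow> \<chi>" if "\<Gamma> \<^bold>\<turnstile> \<phi> \<^bold>\<longrightarrow> \<psi> \<^bold>\<longrightarrow> \<chi>"
    by (rule derives_MP[OF that]) (intro imp_in_PCO PCO.intros PCO)+
  have "\<Gamma> \<^bold>\<turnstile> ((\<phi> \<^bold>\<and> \<psi>) \<^bold>\<longrightarrow> \<chi>) \<^bold>\<longrightarrow> (\<phi> \<^bold>\<longrightarrow> \<psi> \<^bold>\<longrightarrow> \<chi>)"
    using derives_taut[of "PImp (PImp (PAnd (PVar 0) (PVar 1)) (PVar 2))
      (PImp (PVar 0) (PImp (PVar 1) (PVar 2)))" "[\<phi>, \<psi>, \<chi>]" \<Gamma>] PCO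
    by (simp add: tautology_def)
  then show "\<Gamma> \<^bold>\<turnstile> \<phi> \<^bold>\<longrightarrow> \<psi> \<^bold>\<longrightarrow> \<chi>" if "\<Gamma> \<^bold>\<turnstile> (\<phi> \<^bold>\<and> \<psi>) \<^bold>\<longrightarrow> \<chi>"
    by (rule derives_MP[OF that]) (intro imp_in_PCO PCO.intros PCO)+
qed

section \<open>The deduction theorem\<close>

lemma derives_imp_rule:
  assumes \<phi>: "\<phi> \<in> PCO" and E: "E \<subseteq> PCO" "\<And>\<chi>. \<chi> \<in> E \<Longrightarrow> \<Gamma> \<^bold>\<turnstile> \<phi> \<^bold>\<longrightarrow> \<chi>" and "rule E \<chi>"
  shows "\<Gamma> \<^bold>\<turnstile> \<phi> \<^bold>\<longrightarrow> \<chi>"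
  using \<open>rule E \<chi>\<close>
proof cases
  case (MP \<psi>)
  then show ?thesis using derives_imp_MP[of \<Gamma> \<phi> \<psi> \<chi>] E \<phi> by blast
next
  case (bot_omega \<psi> \<alpha>)
  have \<phi>\<psi>: "(\<phi> \<^bold>\<and> \<psi>) \<in> PCO" using \<phi> bot_omega(2) by (rule PCO.intros)
  have bot: "\<^bold>\<bottom> \<in> PCO" using bot_in_CO CO_subset_PCO by blast
  \<comment> \<open>One premise per rational \<epsilon>, hence a countable set, as
    \<open>derives_step\<close> demands.\<close>
  let ?F = "(\<lambda>\<epsilon>. (\<phi> \<^bold>\<and> \<psi>) \<^bold>\<longrightarrow> PrNe \<alpha> \<epsilon>) ` {0..1}"
  have "\<Gamma> \<^bold>\<turnstile> (\<phi> \<^bold>\<and> \<psi>) \<^bold>\<longrightarrow> \<^bold>\<bottom>"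
  proof (rule derives_step)
    show "countable ?F" by (intro countable_image countableI_type)
    show "\<Gamma> \<^bold>\<turnstile> \<theta>" if "\<theta> \<in> ?F" for \<theta>
      using that E(2) bot_omega \<phi> derives_imp_curry Pr_in_PCO(4) by fastforce
    show "step \<Gamma> ?F ((\<phi> \<^bold>\<and> \<psi>) \<^bold>\<longrightarrow> \<^bold>\<bottom>)"
      using rule.bot_omega[OF \<phi>\<psi> bot_omega(3), of ?F] imp_in_PCO[OF \<phi>\<psi> bot]
      by (simp add: step_def)
  qed
  then show ?thesis using derives_imp_curry[OF \<phi> bot_omega(2) bot] bot_omega(1) by simp
next
  case (obs_omega \<psi> \<alpha> \<beta> \<delta>)
  have \<phi>\<psi>: "(\<phi> \<^bold>\<and> \<psi>) \<in> PCO" using \<phi> obs_omega(2) by (rule PCO.intros)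
  have concl: "(\<alpha> \<^bold>\<supset> PrEq \<beta> \<delta>) \<in> PCO"
    using obs_omega by (intro PCO.intros Pr_in_PCO)
  let ?iff = "\<lambda>\<epsilon>. PrEq (\<alpha> \<^bold>\<and> \<beta>) (\<delta> * \<epsilon>) \<^bold>\<longleftrightarrow> PrEq \<alpha> \<epsilon>"
  \<comment> \<open>Currying needs well-formed premises, so the product \<delta> * \<epsilon> must
    again lie in the unit interval.\<close>
  have prem: "?iff \<epsilon> \<in> PCO" if "\<epsilon> \<in> {0<..1}" for \<epsilon>
    using that obs_omega by (intro iff_in_PCO Pr_in_PCO CO.intros) (auto intro: mult_le_one)
  let ?F = "(\<lambda>\<epsilon>. (\<phi> \<^bold>\<and> \<psi>) \<^bold>\<longrightarrow> ?iff \<epsilon>) ` {0<..1}"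
  have "\<Gamma> \<^bold>\<turnstile> (\<phi> \<^bold>\<and> \<psi>) \<^bold>\<longrightarrow> (\<alpha> \<^bold>\<supset> PrEq \<beta> \<delta>)"
  proof (rule derives_step)
    show "countable ?F" by (intro countable_image countableI_type)
    show "\<Gamma> \<^bold>\<turnstile> \<theta>" if "\<theta> \<in> ?F" for \<theta>
      using that E(2) obs_omega(2,6) \<phi> derives_imp_curry prem by blast
    show "step \<Gamma> ?F ((\<phi> \<^bold>\<and> \<psi>) \<^bold>\<longrightarrow> (\<alpha> \<^bold>\<supset> PrEq \<beta> \<delta>))"
      using rule.obs_omega[OF \<phi>\<psi> obs_omega(3-5), of ?F] imp_in_PCO[OF \<phi>\<psi> concl]
      by (simp add: step_def)
  qed
  then show ?thesis using derives_imp_curry[OF \<phi> obs_omega(2) concl] obs_omega(1) by simp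
qed

theorem deduction_theorem:
  assumes "\<phi> \<in> PCO" and "\<Gamma> \<union> {\<phi>} \<^bold>\<turnstile> \<psi>"
  shows "\<Gamma> \<^bold>\<turnstile> \<phi> \<^bold>\<longrightarrow> \<psi>"
proof -
  obtain r s k where d: "derivation theorems (\<Gamma> \<union> {\<phi>}) r s"
    and k: "k \<in> Field r" "s k = \<psi>"
    using assms(2) unfolding derives_def derives_using_def by blast
  then have wo: "Well_order r"
    and steps: "\<And>i. i \<in> Field r \<Longrightarrow> step (\<Gamma> \<union> {\<phi>}) (s ` underS r i) (s i)"
    by (simp_all add: derivation_iff_step)
  have PCO: "s i \<in> PCO" if "i \<in> Field r" for i
    using steps[OF that] by (simp add: step_def)
  have wf: "wf (r - Id)" using wo by (simp add: well_order_on_def)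
  \<comment> \<open>The claim is generalised from the final line to all lines, for well-founded
    induction along the derivation.\<close>
  have "\<Gamma> \<^bold>\<turnstile> \<phi> \<^bold>\<longrightarrow> s i" if "i \<in> Field r" for i
    using that
  proof (induction i rule: wf_induct_rule[OF wf])
    case (1 i)
    let ?E = "s ` underS r i"
    have sub: "underS r i \<subseteq> Field r" by (auto simp: underS_def Field_def)
    have "\<Gamma> \<^bold>\<turnstile> \<phi> \<^bold>\<longrightarrow> s j" if "j \<in> underS r i" for j
      using 1 that sub by (auto simp: underS_def)
    then have E: "?E \<subseteq> PCO" "\<And>\<chi>. \<chi> \<in> ?E \<Longrightarrow> \<Gamma> \<^bold>\<turnstile> \<phi> \<^bold>\<longrightarrow> \<chi>"
      using sub PCO by auto
    consider "s i \<in> axioms" | "s i \<in> \<Gamma>" | "s i = \<phi>" | "rule ?E (s i)"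
      | "thm_rule (?E \<inter> theorems) (s i)"
      using steps[OF \<open>i \<in> Field r\<close>] unfolding step_def by blast
    then show ?case
    proof cases
      case 1
      then show ?thesis
        using assms(1) PCO[OF \<open>i \<in> Field r\<close>] by (intro derives_imp_weaken derives_axiom)
    next
      case 2
      then show ?thesis
        using assms(1) PCO[OF \<open>i \<in> Field r\<close>] by (intro derives_imp_weaken derives_premise)
    next
      case 3
      then show ?thesis using assms(1) derives_imp_refl by simp
    next
      case 4
      with assms(1) E show ?thesis by (rule derives_imp_rule)
    next
      case 5
      \<comment> \<open>The induction hypothesis is bypassed here: the premises of the rule are
        theorems and thus derivable from \<Gamma> alone, so the line itself is derivable without
        \<phi> and only has to be weakened.\<close>
      have "\<Gamma> \<^bold>\<turnstile> s i"
      proof (rule derives_step)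
        show "countable (?E \<inter> theorems)"
          by (intro countable_Int1 countable_image countableI_type)
        show "\<Gamma> \<^bold>\<turnstile> \<chi>" if "\<chi> \<in> ?E \<inter> theorems" for \<chi>
          using that derives_theorem by blast
        show "step \<Gamma> (?E \<inter> theorems) (s i)"
          using 5 PCO[OF \<open>i \<in> Field r\<close>] by (simp add: step_def)
      qed
      then show ?thesis
        using assms(1) PCO[OF \<open>i \<in> Field r\<close>] by (intro derives_imp_weaken)
    qed
  qed
  then show ?thesis using k by blast
qed

end

theorem mainTheorem3:
  fixes \<sigma> :: "('v, 'a) sig"
    and \<Gamma> :: "('v, 'a) fm set"
    and \<phi> \<psi> :: "('v, 'a) fm"
  assumes "signature \<sigma>"
    and "\<Gamma> \<subseteq> signature.PCO \<sigma>"
    and "\<phi> \<in> signature.PCO \<sigma>"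
    and "\<psi> \<in> signature.PCO \<sigma>"
    and "signature.derives \<sigma> (\<Gamma> \<union> {\<phi>}) \<psi>"
  shows "signature.derives \<sigma> \<Gamma> (signature.imp \<sigma> \<phi> \<psi>)"
  using assms(1,3,5) by (rule signature.deduction_theorem)

end
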